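(* Let $\mathcal O$ be either $\mathbb CP^2$ or $\mathcal E$ and let $\boldsymbol p$ be a non trivial irrep of $SU(3)$ on $\mathcal H_{\boldsymbol p}$, with dual irrep $\check{\boldsymbol p}$ on $\mathcal H_{\check{\boldsymbol p}}=\mathcal H_{\boldsymbol p}^*$. If $W:\mathcal B(\mathcal H_{\boldsymbol p})\to C^\infty_{\mathbb C}(\mathcal O)$ and $\check W:\mathcal B(\mathcal H_{\check{\boldsymbol p}})\to C^\infty_{\mathbb C}(\mathcal O)$ are antipodal symbol correspondences, for $\boldsymbol p$ and $\check{\boldsymbol p}$ respectively, then their images coincide, $\mathcal S_{\boldsymbol p}(W)=\mathcal S_{\check{\boldsymbol p}}(\check W)$, and their induced twisted products $\star$ and $\check\star$ satisfy $$f_1\star f_2=f_2\ \check\star\ f_1$$ for every $f_1,f_2\in\mathcal S_{\boldsymbol p}(W)=\mathcal S_{\check{\boldsymbol p}}(\check W)$.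
   Context: $\mathbb CP^2\simeq SU(3)/H$ with $H=\{\mathrm{diag}(\det(U)^{-1},U):U\in U(2)\}$, and $\mathcal E\simeq SU(3)/T$ is the full flag manifold, $T$ the diagonal maximal torus; each has the $SU(3)$-invariant integral of total mass $1$. Irreps are unitary; $\mathcal B(\mathcal H_{\boldsymbol p})$ carries the action $A^g=\rho(g)A\rho(g)^{-1}$, where $\rho$ is the irrep on $\mathcal H_{\boldsymbol p}$; $\dim(\boldsymbol p)=\dim\mathcal H_{\boldsymbol p}$. A symbol correspondence $W:\mathcal B(\mathcal H_{\boldsymbol p})\to C^\infty_{\mathbb C}(\mathcal O)$, $A\mapsto W_A$, is an injective linear map with: (1) $W_{A^g}=(W_A)^g$ for all $g\in SU(3)$, where $f^g(\boldsymbol\varsigma)=f(g^{-1}\boldsymbol\varsigma)$; (2) $W_{A^\dagger}=\overline{W_A}$; (3) $\int_{\mathcal O}W_A\,d\boldsymbol\varsigma=\operatorname{tr}(A)/\dim(\boldsymbol p)$. Its image is denoted $\mathcal S_{\boldsymbol p}(W)$. For $A\in\mathcal B(\mathcal H_{\boldsymbol p})$, $A^*\in\mathcal B(\mathcal H_{\boldsymbol p}^* )$ is the adjoint (transpose) $A^*\varphi=\varphi\circ A$. The antipodal correspondence of $W$ is $\check W:\mathcal B(\mathcal H_{\check{\boldsymbol p}})\to C^\infty_{\mathbb C}(\mathcal O)$ given by $\check W_{A^*}=W_A$. The twisted product induced by a symbol correspondence $W$ on its image $\mathcal S_{\boldsymbol p}(W)$ is the product given by $W_{A_1}\star W_{A_2}=W_{A_1A_2}$.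 *)

theory Defs
  imports "HOL-Analysis.Analysis"
begin

section \<open>Finite-dimensional complex Hilbert spaces\<close>

text \<open>The inner product is conjugate-linear in its first argument.\<close>

class fd_hilbert = ab_group_add +
  fixes scaleC :: "complex \<Rightarrow> 'a \<Rightarrow> 'a" (infixr "*\<^sub>C" 75)
    and cinner :: "'a \<Rightarrow> 'a \<Rightarrow> complex"
  assumes scaleC_add_right: "c *\<^sub>C (x + y) = c *\<^sub>C x + c *\<^sub>C y"
    and scaleC_add_left: "(c + d) *\<^sub>C x = c *\<^sub>C x + d *\<^sub>C x"
    and scaleC_scaleC: "c *\<^sub>C (d *\<^sub>C x) = (c * d) *\<^sub>C x"
    and scaleC_one: "1 *\<^sub>C x = x"
    and cinner_commute: "cinner x y = cnj (cinner y x)"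
    and cinner_add_right: "cinner x (y + z) = cinner x y + cinner x z"
    and cinner_scaleC_right: "cinner x (c *\<^sub>C y) = c * cinner x y"
    and cinner_ge_zero: "Im (cinner x x) = 0 \<and> 0 \<le> Re (cinner x x)"
    and cinner_eq_zeroD: "cinner x x = 0 \<Longrightarrow> x = 0"
    and finite_generators: "\<exists>B. finite B \<and> (\<forall>x. \<exists>c. x = (\<Sum>b\<in>B. c b *\<^sub>C b))"

interpretation fdh: vector_space "scaleC :: complex \<Rightarrow> 'a::fd_hilbert \<Rightarrow> 'a"
  by unfold_locales (simp_all add: scaleC_add_right scaleC_add_left scaleC_scaleC scaleC_one)

abbreviation clinear :: "('a::fd_hilbert \<Rightarrow> 'b::fd_hilbert) \<Rightarrow> bool" where
  "clinear \<equiv> Vector_Spaces.linear scaleC scaleC"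

abbreviation cfunctional :: "('a::fd_hilbert \<Rightarrow> complex) \<Rightarrow> bool" where
  "cfunctional \<equiv> Vector_Spaces.linear scaleC (*)"

definition ops :: "('a::fd_hilbert \<Rightarrow> 'a) set" where
  "ops = {A. clinear A}"

definition cadjoint :: "('a::fd_hilbert \<Rightarrow> 'a) \<Rightarrow> 'a \<Rightarrow> 'a" where
  "cadjoint A = (THE B. \<forall>u v. cinner (A u) v = cinner u (B v))"

definition cbasis :: "'a::fd_hilbert set" where
  "cbasis = (SOME B. fdh.independent B \<and> fdh.span B = UNIV)"

definition ctrace :: "('a::fd_hilbert \<Rightarrow> 'a) \<Rightarrow> complex" where
  "ctrace A = (\<Sum>b\<in>cbasis. fdh.representation cbasis (A b) b)"


section \<open>The dual Hilbert space\<close>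

lemma cfunctional_iff:
  "cfunctional f \<longleftrightarrow> (\<forall>x y. f (x + y) = f x + f y) \<and> (\<forall>c x. f (c *\<^sub>C x) = c * f x)"
proof -
  have "vector_space ((*) :: complex \<Rightarrow> complex \<Rightarrow> complex)"
    by unfold_locales (simp_all add: algebra_simps)
  then show ?thesis
    by (auto simp: Vector_Spaces.linear_def module_hom_def module_hom_axioms_def
        vector_space_def module_def fdh.vector_space_axioms[unfolded vector_space_def])
qed

lemma cinner_add_left: "cinner (x + y) (z::'a::fd_hilbert) = cinner x z + cinner y z"
  by (metis cinner_add_right cinner_commute complex_cnj_add)

lemma cinner_scaleC_left: "cinner (c *\<^sub>C x) (y::'a::fd_hilbert) = cnj c * cinner x y"
  by (metis cinner_scaleC_right cinner_commute complex_cnj_mult)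

lemma cinner_zero_right [simp]: "cinner (x::'a::fd_hilbert) 0 = 0"
  using cinner_add_right[of x 0 0] by simp

lemma cinner_zero_left [simp]: "cinner 0 (x::'a::fd_hilbert) = 0"
  using cinner_add_left[of 0 0 x] by simp

lemma cinner_diff_right: "cinner (x::'a::fd_hilbert) (y - z) = cinner x y - cinner x z"
  using cinner_add_right[of x "y - z" z] by simp

lemma cinner_diff_left: "cinner (x - y) (z::'a::fd_hilbert) = cinner x z - cinner y z"
  using cinner_add_left[of "x - y" y z] by simp

lemma cinner_sum_left:
  "cinner (\<Sum>b\<in>B. f b) (z::'a::fd_hilbert) = (\<Sum>b\<in>B. cinner (f b) z)"
  by (induction B rule: infinite_finite_induct) (simp_all add: cinner_add_left)

lemma riesz_unique:
  assumes "\<And>v. cinner r v = cinner s (v::'a::fd_hilbert)"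
  shows "r = s"
proof -
  have "cinner (r - s) (r - s) = 0"
    by (simp add: cinner_diff_left assms)
  then show ?thesis
    using cinner_eq_zeroD by fastforce
qed

lemma riesz_span:
  assumes "finite B" and "cfunctional (f :: 'a::fd_hilbert \<Rightarrow> complex)"
  shows "\<exists>r\<in>fdh.span B. \<forall>v\<in>fdh.span B. f v = cinner r v"
  using assms
proof (induction B arbitrary: f rule: finite_induct)
  case empty
  then have "f 0 = 0"
    unfolding cfunctional_iff by (metis add_cancel_left_left)
  then show ?case by simp
next
  case (insert b B)
  obtain r where r: "r \<in> fdh.span B" "\<And>v. v \<in> fdh.span B \<Longrightarrow> f v = cinner r v"
    using insert by blast
  have "cfunctional (cinner b)"
    by (simp add: cfunctional_iff cinner_add_right cinner_scaleC_right)
  then obtain s where s: "s \<in> fdh.span B" "\<And>v. v \<in> fdh.span B \<Longrightarrow> cinner b v = cinner s v"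
    using insert.IH by blast
  define e where "e = b - s"
  have eperp: "cinner e v = 0" if "v \<in> fdh.span B" for v
    using s(2)[OF that] by (simp add: e_def cinner_diff_left)
  have perpe: "cinner v e = 0" if "v \<in> fdh.span B" for v
    using eperp[OF that] cinner_commute[of v e] by simp
  have f_add: "f (x + y) = f x + f y" and f_scale: "f (c *\<^sub>C x) = c * f x" for x y c
    using insert.prems by (auto simp: cfunctional_iff)
  define k where "k = f e / cinner e e"
  define t where "t = r + cnj k *\<^sub>C e"
  have span_mono: "v \<in> fdh.span (insert b B)" if "v \<in> fdh.span B" for v
    using that fdh.span_mono[of B "insert b B"] by blast
  have e_in: "e \<in> fdh.span (insert b B)"
    unfolding e_def using span_mono s(1) by (intro fdh.span_diff) (simp_all add: fdh.span_base)
  have "t \<in> fdh.span (insert b B)"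
    unfolding t_def using e_in span_mono r(1) by (intro fdh.span_add fdh.span_scale)
  moreover have "f v = cinner t v" if v: "v \<in> fdh.span (insert b B)" for v
  proof -
    obtain c where c: "v - c *\<^sub>C b \<in> fdh.span B"
      using v fdh.span_breakdown_eq by metis
    define w where "w = (v - c *\<^sub>C b) + c *\<^sub>C s"
    have w: "w \<in> fdh.span B"
      unfolding w_def using c s(1) by (intro fdh.span_add fdh.span_scale)
    have v_eq: "v = c *\<^sub>C e + w"
      by (simp add: w_def e_def fdh.scale_right_diff_distrib)
    have "k * cinner e e = f e"
    proof (cases "cinner e e = 0")
      case True
      then have "e = 0" by (rule cinner_eq_zeroD)
      moreover have "f 0 = 0" using f_add[of 0 0] by simp
      ultimately show ?thesis by simp
    qed (simp add: k_def)
    then show ?thesis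
      unfolding v_eq t_def
      by (simp add: f_add f_scale r(2)[OF w] cinner_add_left cinner_add_right
          cinner_scaleC_left cinner_scaleC_right perpe[OF r(1)] eperp[OF w] algebra_simps)
  qed
  ultimately show ?case by blast
qed

lemma riesz_exists:
  assumes "cfunctional (f :: 'a::fd_hilbert \<Rightarrow> complex)"
  shows "\<exists>r. \<forall>v. f v = cinner r v"
proof -
  obtain B :: "'a set" where "finite B" and gen: "\<forall>x. \<exists>c. x = (\<Sum>b\<in>B. c b *\<^sub>C b)"
    using finite_generators by blast
  have "x \<in> fdh.span B" for x
  proof -
    obtain c where x: "x = (\<Sum>b\<in>B. c b *\<^sub>C b)" using gen by blast
    show ?thesis
      unfolding x by (intro fdh.span_sum fdh.span_scale fdh.span_base)
  qed
  then have "fdh.span B = UNIV" by blast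
  then show ?thesis
    using riesz_span[OF \<open>finite B\<close> assms] by auto
qed

typedef (overloaded) 'a cdual = "{f :: 'a::fd_hilbert \<Rightarrow> complex. cfunctional f}"
  morphisms dual_apply Abs_cdual
  by (rule exI[of _ "\<lambda>_. 0"]) (simp add: cfunctional_iff)

text \<open>The vector representing a functional through the inner product.\<close>

definition riesz :: "'a::fd_hilbert cdual \<Rightarrow> 'a" where
  "riesz \<phi> = (THE r. \<forall>v. dual_apply \<phi> v = cinner r v)"

lemma riesz: "dual_apply \<phi> v = cinner (riesz \<phi>) (v::'a::fd_hilbert)"
proof -
  have "cfunctional (dual_apply \<phi>)"
    using dual_apply[of \<phi>] by simp
  then obtain r where r: "\<forall>v. dual_apply \<phi> v = cinner r v"
    using riesz_exists by blast
  have "riesz \<phi> = r"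
    unfolding riesz_def
  proof (rule the_equality[where P = "\<lambda>r. \<forall>v. dual_apply \<phi> v = cinner r v", OF r])
    fix s assume "\<forall>v. dual_apply \<phi> v = cinner s v"
    with r have "cinner s v = cinner r v" for v by metis
    then show "s = r" by (rule riesz_unique)
  qed
  with r show ?thesis by simp
qed

lemma dual_apply_add: "dual_apply \<phi> (x + y) = dual_apply \<phi> x + dual_apply \<phi> y"
  and dual_apply_scaleC: "dual_apply \<phi> (c *\<^sub>C x) = c * dual_apply \<phi> x"
  using dual_apply[of \<phi>] by (auto simp: cfunctional_iff)

instantiation cdual :: (fd_hilbert) ab_group_add
begin

definition zero_cdual :: "'a cdual" where
  "0 = Abs_cdual (\<lambda>_. 0)"
definition plus_cdual :: "'a cdual \<Rightarrow> 'a cdual \<Rightarrow> 'a cdual" where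
  "\<phi> + \<psi> = Abs_cdual (\<lambda>v. dual_apply \<phi> v + dual_apply \<psi> v)"
definition uminus_cdual :: "'a cdual \<Rightarrow> 'a cdual" where
  "- \<phi> = Abs_cdual (\<lambda>v. - dual_apply \<phi> v)"
definition minus_cdual :: "'a cdual \<Rightarrow> 'a cdual \<Rightarrow> 'a cdual" where
  "\<phi> - \<psi> = Abs_cdual (\<lambda>v. dual_apply \<phi> v - dual_apply \<psi> v)"

lemma dual_apply_zero [simp]: "dual_apply (0 :: 'a cdual) v = 0"
  unfolding zero_cdual_def by (subst Abs_cdual_inverse) (auto simp: cfunctional_iff)

lemma dual_apply_plus [simp]: "dual_apply (\<phi> + \<psi> :: 'a cdual) v = dual_apply \<phi> v + dual_apply \<psi> v"
  unfolding plus_cdual_def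
  by (subst Abs_cdual_inverse)
    (auto simp: cfunctional_iff dual_apply_add dual_apply_scaleC algebra_simps)

lemma dual_apply_uminus [simp]: "dual_apply (- \<phi> :: 'a cdual) v = - dual_apply \<phi> v"
  unfolding uminus_cdual_def
  by (subst Abs_cdual_inverse)
    (auto simp: cfunctional_iff dual_apply_add dual_apply_scaleC algebra_simps)

lemma dual_apply_minus [simp]: "dual_apply (\<phi> - \<psi> :: 'a cdual) v = dual_apply \<phi> v - dual_apply \<psi> v"
  unfolding minus_cdual_def
  by (subst Abs_cdual_inverse)
    (auto simp: cfunctional_iff dual_apply_add dual_apply_scaleC algebra_simps)

instance
  by standard (simp_all add: dual_apply_inject[symmetric] fun_eq_iff algebra_simps)

end

instantiation cdual :: (fd_hilbert) fd_hilbert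
begin

definition scaleC_cdual :: "complex \<Rightarrow> 'a cdual \<Rightarrow> 'a cdual" where
  "c *\<^sub>C \<phi> = Abs_cdual (\<lambda>v. c * dual_apply \<phi> v)"

text \<open>The arguments are swapped because \<^term>\<open>riesz\<close> is conjugate-linear.\<close>

definition cinner_cdual :: "'a cdual \<Rightarrow> 'a cdual \<Rightarrow> complex" where
  "cinner \<phi> \<psi> = cinner (riesz \<psi>) (riesz \<phi>)"

lemma dual_apply_scale [simp]: "dual_apply (c *\<^sub>C \<phi> :: 'a cdual) v = c * dual_apply \<phi> v"
  unfolding scaleC_cdual_def
  by (subst Abs_cdual_inverse)
    (auto simp: cfunctional_iff dual_apply_add dual_apply_scaleC algebra_simps)

lemma riesz_add: "riesz (\<phi> + \<psi> :: 'a cdual) = riesz \<phi> + riesz \<psi>"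
  by (rule riesz_unique) (simp add: riesz[symmetric] cinner_add_left)

lemma riesz_scaleC: "riesz (c *\<^sub>C \<phi> :: 'a cdual) = cnj c *\<^sub>C riesz \<phi>"
  by (rule riesz_unique) (simp add: riesz[symmetric] cinner_scaleC_left)

instance
proof
  fix c d :: complex and \<phi> \<psi> \<theta> :: "'a cdual"
  show "c *\<^sub>C (\<phi> + \<psi>) = c *\<^sub>C \<phi> + c *\<^sub>C \<psi>" "(c + d) *\<^sub>C \<phi> = c *\<^sub>C \<phi> + d *\<^sub>C \<phi>"
    "c *\<^sub>C d *\<^sub>C \<phi> = (c * d) *\<^sub>C \<phi>" "1 *\<^sub>C \<phi> = \<phi>"
    by (simp_all add: dual_apply_inject[symmetric] fun_eq_iff algebra_simps)
  show "cinner \<phi> \<psi> = cnj (cinner \<psi> \<phi>)"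
    unfolding cinner_cdual_def by (rule cinner_commute)
  show "cinner \<phi> (\<psi> + \<theta>) = cinner \<phi> \<psi> + cinner \<phi> \<theta>"
    by (simp add: cinner_cdual_def riesz_add cinner_add_left)
  show "cinner \<phi> (c *\<^sub>C \<psi>) = c * cinner \<phi> \<psi>"
    by (simp add: cinner_cdual_def riesz_scaleC cinner_scaleC_left)
  show "Im (cinner \<phi> \<phi>) = 0 \<and> 0 \<le> Re (cinner \<phi> \<phi>)"
    unfolding cinner_cdual_def by (rule cinner_ge_zero)
  show "\<phi> = 0" if "cinner \<phi> \<phi> = 0"
  proof -
    have "riesz \<phi> = 0"
      using that unfolding cinner_cdual_def by (rule cinner_eq_zeroD)
    then have "dual_apply \<phi> v = dual_apply 0 v" for v
      by (subst riesz) simp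
    then show ?thesis
      by (simp add: dual_apply_inject[symmetric] fun_eq_iff)
  qed
next
  obtain B :: "'a set" where fin: "finite B" and gen: "\<forall>x. \<exists>c. x = (\<Sum>b\<in>B. c b *\<^sub>C b)"
    using finite_generators by blast
  define j :: "'a \<Rightarrow> 'a cdual" where "j b = Abs_cdual (cinner b)" for b
  have j: "dual_apply (j b) v = cinner b v" for b v
    unfolding j_def
    by (subst Abs_cdual_inverse) (auto simp: cfunctional_iff cinner_add_right cinner_scaleC_right)
  have inj: "inj_on j B"
    by (rule inj_onI) (metis j riesz_unique)
  have sum: "dual_apply (sum f A :: 'a cdual) v = (\<Sum>a\<in>A. dual_apply (f a) v)"
    for f v and A :: "'a set"
    by (induction A rule: infinite_finite_induct) simp_all
  have "\<exists>c. \<phi> = (\<Sum>b\<in>j ` B. c b *\<^sub>C b)" for \<phi> :: "'a cdual"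
  proof -
    obtain c where c: "riesz \<phi> = (\<Sum>b\<in>B. c b *\<^sub>C b)" using gen by blast
    have "dual_apply \<phi> v = (\<Sum>b\<in>B. cnj (c b) * cinner b v)" for v
      by (subst riesz) (simp add: c cinner_sum_left cinner_scaleC_left)
    then have "\<phi> = (\<Sum>b\<in>B. cnj (c b) *\<^sub>C j b)"
      by (simp add: dual_apply_inject[symmetric] fun_eq_iff sum j)
    also have "\<dots> = (\<Sum>b\<in>j ` B. cnj (c (inv_into B j b)) *\<^sub>C b)"
      by (simp add: sum.reindex[OF inj] inv_into_f_f[OF inj])
    finally show ?thesis by (rule exI[of _ "\<lambda>b. cnj (c (inv_into B j b))"])
  qed
  then show "\<exists>B :: 'a cdual set. finite B \<and> (\<forall>x. \<exists>c. x = (\<Sum>b\<in>B. c b *\<^sub>C b))"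
    using fin by (intro exI[of _ "j ` B"]) simp
qed

end

text \<open>The transpose \<open>A\<^sup>*\<close> acts on the dual space; it is not the Hermitian adjoint
  \<^term>\<open>cadjoint A\<close>, which acts on the space itself.\<close>

definition transp :: "('a::fd_hilbert \<Rightarrow> 'a) \<Rightarrow> 'a cdual \<Rightarrow> 'a cdual" where
  "transp A \<phi> = Abs_cdual (dual_apply \<phi> \<circ> A)"


section \<open>The group \<open>SU(3)\<close> and its homogeneous spaces\<close>

type_synonym cmat3 = "complex^3^3"

definition conj_transpose :: "complex^'n^'m \<Rightarrow> complex^'m^'n" where
  "conj_transpose A = (\<chi> i j. cnj (A $ j $ i))"

definition U2 :: "(complex^2^2) set" where
  "U2 = {U. U ** conj_transpose U = mat 1}"

definition SU3 :: "cmat3 set" where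
  "SU3 = {U. U ** conj_transpose U = mat 1 \<and> det U = 1}"

definition H_CP2 :: "cmat3 set" where
  "H_CP2 = {vector [vector [inverse (det U), 0, 0],
                    vector [0, U $ 1 $ 1, U $ 1 $ 2],
                    vector [0, U $ 2 $ 1, U $ 2 $ 2]] | U. U \<in> U2}"

definition T_flag :: "cmat3 set" where
  "T_flag = {U \<in> SU3. \<forall>i j. i \<noteq> j \<longrightarrow> U $ i $ j = 0}"

text \<open>For a closed subgroup \<open>K\<close>, the homogeneous space \<open>SU(3)/K\<close> is the set of left cosets
  \<open>g K\<close>. A function on it is a function on sets of matrices that vanishes at every argument
  that is not such a coset.\<close>

definition coset :: "cmat3 set \<Rightarrow> cmat3 \<Rightarrow> cmat3 set" where
  "coset K g = (\<lambda>k. g ** k) ` K"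

definition orbit_space :: "cmat3 set \<Rightarrow> cmat3 set set" where
  "orbit_space K = coset K ` SU3"

definition act :: "cmat3 \<Rightarrow> cmat3 set \<Rightarrow> cmat3 set" where
  "act g x = (\<lambda>h. g ** h) ` x"

definition quotient_opens :: "cmat3 set \<Rightarrow> cmat3 set set set" where
  "quotient_opens K =
     {V. V \<subseteq> orbit_space K \<and> openin (top_of_set SU3) {g \<in> SU3. coset K g \<in> V}}"

definition invariant_probability :: "cmat3 set \<Rightarrow> cmat3 set measure \<Rightarrow> bool" where
  "invariant_probability K \<mu> \<longleftrightarrow>
     space \<mu> = orbit_space K \<and> sets \<mu> = sigma_sets (orbit_space K) (quotient_opens K) \<and>
     emeasure \<mu> (space \<mu>) = 1 \<and> (\<forall>g\<in>SU3. distr \<mu> \<mu> (act g) = \<mu>)"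

text \<open>Existence and uniqueness are those of the normalized Haar measure, pushed forward to the
  quotient by the closed subgroup \<open>K\<close>.\<close>

definition inv_measure :: "cmat3 set \<Rightarrow> cmat3 set measure" where
  "inv_measure K = (THE \<mu>. invariant_probability K \<mu>)"

primrec k_smooth_on :: "nat \<Rightarrow> 'a::real_normed_vector set \<Rightarrow> ('a \<Rightarrow> 'b::real_normed_vector) \<Rightarrow> bool"
where
  "k_smooth_on 0 S f \<longleftrightarrow> continuous_on S f"
| "k_smooth_on (Suc k) S f \<longleftrightarrow>
     (\<forall>x\<in>S. f differentiable (at x)) \<and>
     (\<forall>v. k_smooth_on k S (\<lambda>x. frechet_derivative f (at x) v))"

text \<open>Since \<open>SU(3)\<close> is an embedded submanifold of the space of matrices and \<open>SU(3) \<rightarrow> SU(3)/K\<close>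
  is a submersion, a function on the quotient is smooth iff its pullback to \<open>SU(3)\<close> locally
  extends to a smooth function of matrices (as a real vector space).\<close>

definition smooth_functions :: "cmat3 set \<Rightarrow> (cmat3 set \<Rightarrow> complex) set" where
  "smooth_functions K =
     {f. (\<forall>x. x \<notin> orbit_space K \<longrightarrow> f x = 0) \<and>
         (\<forall>g\<in>SU3. \<exists>S F. open S \<and> g \<in> S \<and> (\<forall>k. k_smooth_on k S F) \<and>
            (\<forall>h\<in>S \<inter> SU3. F h = f (coset K h)))}"


section \<open>Irreducible representations\<close>

text \<open>Since the space is finite-dimensional, continuity is continuity of all matrix coefficients.\<close>

definition unitary_rep :: "(cmat3 \<Rightarrow> 'a::fd_hilbert \<Rightarrow> 'a) \<Rightarrow> bool" where
  "unitary_rep \<rho> \<longleftrightarrow>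
     (\<forall>g\<in>SU3. clinear (\<rho> g)) \<and>
     (\<forall>g\<in>SU3. \<forall>u v. cinner (\<rho> g u) (\<rho> g v) = cinner u v) \<and>
     \<rho> (mat 1) = id \<and>
     (\<forall>g\<in>SU3. \<forall>h\<in>SU3. \<rho> (g ** h) = \<rho> g \<circ> \<rho> h) \<and>
     (\<forall>u v. continuous_on SU3 (\<lambda>g. cinner u (\<rho> g v)))"

definition unitary_irrep :: "(cmat3 \<Rightarrow> 'a::fd_hilbert \<Rightarrow> 'a) \<Rightarrow> bool" where
  "unitary_irrep \<rho> \<longleftrightarrow>
     unitary_rep \<rho> \<and> (UNIV :: 'a set) \<noteq> {0} \<and>
     (\<forall>S. fdh.subspace S \<and> (\<forall>g\<in>SU3. \<rho> g ` S \<subseteq> S) \<longrightarrow> S = {0} \<or> S = UNIV)"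

definition trivial_rep :: "(cmat3 \<Rightarrow> 'a::fd_hilbert \<Rightarrow> 'a) \<Rightarrow> bool" where
  "trivial_rep \<rho> \<longleftrightarrow> (\<forall>g\<in>SU3. \<rho> g = id)"

definition dual_rep :: "(cmat3 \<Rightarrow> 'a::fd_hilbert \<Rightarrow> 'a) \<Rightarrow> cmat3 \<Rightarrow> 'a cdual \<Rightarrow> 'a cdual" where
  "dual_rep \<rho> g = transp (\<rho> (matrix_inv g))"


section \<open>Symbol correspondences\<close>

text \<open>A correspondence \<open>W\<close> is only meaningful on \<^term>\<open>ops\<close>; its values at non-linear maps are
  arbitrary.\<close>

definition symbol_correspondence ::
  "cmat3 set \<Rightarrow> (cmat3 \<Rightarrow> 'a::fd_hilbert \<Rightarrow> 'a) \<Rightarrow> (('a \<Rightarrow> 'a) \<Rightarrow> cmat3 set \<Rightarrow> complex) \<Rightarrow> bool" where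
  "symbol_correspondence K \<rho> W \<longleftrightarrow>
     W ` ops \<subseteq> smooth_functions K \<and>
     inj_on W ops \<and>
     (\<forall>A\<in>ops. \<forall>B\<in>ops. W (\<lambda>v. A v + B v) = (\<lambda>x. W A x + W B x)) \<and>
     (\<forall>c. \<forall>A\<in>ops. W (\<lambda>v. c *\<^sub>C A v) = (\<lambda>x. c * W A x)) \<and>
     (\<forall>g\<in>SU3. \<forall>A\<in>ops. \<forall>x\<in>orbit_space K.
        W (\<rho> g \<circ> A \<circ> inv (\<rho> g)) x = W A (act (matrix_inv g) x)) \<and>
     (\<forall>A\<in>ops. W (cadjoint A) = (\<lambda>x. cnj (W A x))) \<and>
     (\<forall>A\<in>ops. (\<integral>x. W A x \<partial>inv_measure K) = ctrace A / of_nat (fdh.dim (UNIV :: 'a set)))"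

definition symbols :: "(('a::fd_hilbert \<Rightarrow> 'a) \<Rightarrow> cmat3 set \<Rightarrow> complex) \<Rightarrow> (cmat3 set \<Rightarrow> complex) set" where
  "symbols W = W ` ops"

definition antipodal ::
  "(('a::fd_hilbert \<Rightarrow> 'a) \<Rightarrow> cmat3 set \<Rightarrow> complex) \<Rightarrow>
   (('a cdual \<Rightarrow> 'a cdual) \<Rightarrow> cmat3 set \<Rightarrow> complex) \<Rightarrow> bool" where
  "antipodal W W' \<longleftrightarrow> (\<forall>A\<in>ops. W' (transp A) = W A)"

definition twisted_product ::
  "(('a::fd_hilbert \<Rightarrow> 'a) \<Rightarrow> cmat3 set \<Rightarrow> complex) \<Rightarrow>
   (cmat3 set \<Rightarrow> complex) \<Rightarrow> (cmat3 set \<Rightarrow> complex) \<Rightarrow> cmat3 set \<Rightarrow> complex" where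
  "twisted_product W f1 f2 = W (inv_into ops W f1 \<circ> inv_into ops W f2)"

end

theory Submission
  imports Defs
begin

text \<open>Transposition is a bijection from the operators on \<open>H\<close> onto those on \<open>H\<^sup>*\<close> that reverses
  composition. Since \<open>W'\<close> composed with it is \<open>W\<close>, the images agree and the products are opposite.\<close>

lemma clinear_iff:
  "clinear f \<longleftrightarrow> (\<forall>x y. f (x + y) = f x + f y) \<and> (\<forall>c x. f (c *\<^sub>C x) = c *\<^sub>C f x)"
  by (auto simp: Vector_Spaces.linear_def module_hom_def module_hom_axioms_def
      vector_space_def module_def fdh.vector_space_axioms[unfolded vector_space_def])

lemma dual_apply_Abs_cdual: "cfunctional f \<Longrightarrow> dual_apply (Abs_cdual f) = f"
  by (simp add: Abs_cdual_inverse)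

lemma cdual_eqI: "(\<And>v. dual_apply \<phi> v = dual_apply \<psi> v) \<Longrightarrow> \<phi> = \<psi>"
  by (simp add: dual_apply_inject[symmetric] fun_eq_iff)

lemma ops_comp: "A \<in> ops \<Longrightarrow> B \<in> ops \<Longrightarrow> A \<circ> B \<in> ops"
  by (simp add: ops_def clinear_iff)

text \<open>\<open>Abs_cdual\<close> is determined only on linear functionals, so linearity of
  \<open>A\<close> is what allows \<open>transp A\<close> to be evaluated as precomposition.\<close>

lemma dual_apply_transp:
  assumes "A \<in> ops"
  shows "dual_apply (transp A \<phi>) v = dual_apply \<phi> (A v)"
proof -
  have "cfunctional (dual_apply \<phi> \<circ> A)"
    using assms by (simp add: ops_def clinear_iff cfunctional_iff dual_apply_add dual_apply_scaleC)
  then show ?thesis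
    by (simp add: transp_def dual_apply_Abs_cdual)
qed

lemma transp_in_ops: "A \<in> ops \<Longrightarrow> transp A \<in> ops"
  by (auto simp: ops_def[where 'a = "'a cdual"] clinear_iff dual_apply_transp intro!: cdual_eqI)

text \<open>Associativity of composition: \<phi> after \<open>A \<circ> B\<close> is (\<phi> after
  \<open>A\<close>) after \<open>B\<close>, so \<open>transp A\<close> acts first. This reversal is
  what swaps the factors of the twisted products.\<close>

lemma transp_comp: "A \<in> ops \<Longrightarrow> B \<in> ops \<Longrightarrow> transp (A \<circ> B) = transp B \<circ> transp A"
  by (auto simp: fun_eq_iff ops_comp dual_apply_transp intro!: cdual_eqI)

text \<open>Finite dimension enters here, through Riesz representation: for fixed \<open>v\<close>,
  evaluating \<open>B \<phi>\<close> at \<open>v\<close> is linear in \<phi>, hence is evaluation of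
  \<phi> at some vector, which serves as \<open>A v\<close>.\<close>

lemma transp_surj:
  fixes B :: "'a::fd_hilbert cdual \<Rightarrow> 'a cdual"
  assumes "B \<in> ops"
  shows "B \<in> transp ` ops"
proof -
  have B_add: "B (\<phi> + \<psi>) = B \<phi> + B \<psi>" and B_scale: "B (c *\<^sub>C \<phi>) = c *\<^sub>C B \<phi>" for \<phi> \<psi> c
    using assms by (auto simp: ops_def clinear_iff)
  \<comment> \<open>The conjugate-linear inverse of \<open>riesz\<close>.\<close>
  define j :: "'a \<Rightarrow> 'a cdual" where "j u = Abs_cdual (cinner u)" for u
  have j: "dual_apply (j u) v = cinner u v" for u v
    unfolding j_def
    by (subst dual_apply_Abs_cdual) (auto simp: cfunctional_iff cinner_add_right cinner_scaleC_right)
  have j_add: "j (u + v) = j u + j v" and j_scale: "j (c *\<^sub>C u) = cnj c *\<^sub>C j u" for u v c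
    by (auto intro!: cdual_eqI simp: j cinner_add_left cinner_scaleC_left)
  have j_riesz: "j (riesz \<phi>) = \<phi>" for \<phi>
    by (rule cdual_eqI) (metis j riesz)
  have "\<exists>r. \<forall>u. dual_apply (B (j u)) v = cinner u r" for v
  proof -
    \<comment> \<open>The conjugation offsets the conjugate-linearity of \<open>j\<close>, so that
      \<open>riesz_exists\<close> applies.\<close>
    have "cfunctional (\<lambda>u. cnj (dual_apply (B (j u)) v))"
      by (simp add: cfunctional_iff j_add j_scale B_add B_scale)
    then obtain r where "\<And>u. cnj (dual_apply (B (j u)) v) = cinner r u"
      using riesz_exists by blast
    then show ?thesis
      by (metis cinner_commute complex_cnj_cnj)
  qed
  then obtain A where A: "\<And>u v. dual_apply (B (j u)) v = cinner u (A v)"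
    by metis
  have apply_A: "dual_apply \<phi> (A v) = dual_apply (B \<phi>) v" for \<phi> v
    using A[of "riesz \<phi>" v] by (simp add: j_riesz riesz)
  \<comment> \<open>\<open>A\<close> was chosen pointwise; its linearity follows from that of each
    \<phi> because functionals separate points.\<close>
  have sep: "x = y" if "\<And>\<phi>. dual_apply \<phi> x = dual_apply \<phi> y" for x y :: 'a
    using that[of "j _"] by (metis cinner_commute j riesz_unique)
  have "A \<in> ops"
    by (auto simp: ops_def clinear_iff apply_A dual_apply_add dual_apply_scaleC intro!: sep)
  moreover from this have "transp A = B"
    by (auto simp: fun_eq_iff dual_apply_transp apply_A intro!: cdual_eqI)
  ultimately show ?thesis by blast
qed

theorem proposition3p23:
  fixes K :: "cmat3 set"
    and \<rho> :: "cmat3 \<Rightarrow> 'h::fd_hilbert \<Rightarrow> 'h"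
    and W :: "('h \<Rightarrow> 'h) \<Rightarrow> cmat3 set \<Rightarrow> complex"
    and W' :: "('h cdual \<Rightarrow> 'h cdual) \<Rightarrow> cmat3 set \<Rightarrow> complex"
  assumes "K = H_CP2 \<or> K = T_flag"
    and "unitary_irrep \<rho>" and "\<not> trivial_rep \<rho>"
    and "symbol_correspondence K \<rho> W"
    and "symbol_correspondence K (dual_rep \<rho>) W'"
    and "antipodal W W'"
  shows "symbols W = symbols W' \<and>
    (\<forall>f1\<in>symbols W. \<forall>f2\<in>symbols W. twisted_product W f1 f2 = twisted_product W' f2 f1)"
proof -
  have inj: "inj_on W ops" "inj_on W' ops"
    using assms(4,5) by (simp_all add: symbol_correspondence_def)
  have W': "W' (transp A) = W A" if "A \<in> ops" for A
    using assms(6) that by (simp add: antipodal_def)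
  \<comment> \<open>Antipodality prescribes \<open>W'\<close> on transposes only; surjectivity makes
    these all operators on the dual.\<close>
  have "transp ` ops = (ops :: ('h cdual \<Rightarrow> 'h cdual) set)"
    using transp_in_ops transp_surj by blast
  then have "symbols W' = (\<lambda>A. W' (transp A)) ` ops"
    by (metis image_image symbols_def)
  then have "symbols W = symbols W'"
    by (simp add: symbols_def W' cong: image_cong_simp)
  moreover have "twisted_product W f1 f2 = twisted_product W' f2 f1"
    if "f1 \<in> symbols W" "f2 \<in> symbols W" for f1 f2
  proof -
    from that obtain A1 A2 where A: "A1 \<in> ops" "A2 \<in> ops" and f: "f1 = W A1" "f2 = W A2"
      by (auto simp: symbols_def)
    \<comment> \<open>By injectivity the preimages chosen by \<open>inv_into\<close> are the
      expected ones: one symbol stands for \<open>A\<close> under \<open>W\<close> and for its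
      transpose under \<open>W'\<close>.\<close>
    have inv_W: "inv_into ops W (W A) = A" and inv_W': "inv_into ops W' (W A) = transp A"
      if "A \<in> ops" for A
      using inv_into_f_f[OF inj(1) that] inv_into_f_f[OF inj(2) transp_in_ops[OF that]] W'[OF that]
      by simp_all
    have "twisted_product W f1 f2 = W (A1 \<circ> A2)"
      using A by (simp add: twisted_product_def f inv_W)
    \<comment> \<open>Antipodality is applied to the product \<open>A1 \<circ> A2\<close>, whose
      transpose then splits in reverse order.\<close>
    also have "\<dots> = W' (transp A2 \<circ> transp A1)"
      using A by (simp add: W' ops_comp flip: transp_comp)
    also have "\<dots> = twisted_product W' f2 f1"
      using A by (simp add: twisted_product_def f inv_W')
    finally show ?thesis .
  qed
  ultimately show ?thesis by blast
qed

end
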